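(* Let $A$ be an associative algebra over a field $\Bbbk$, and let $\beta,\gamma:A\to A$ be two Baxter operators on $A$ that commute, i.e. $\beta\gamma=\gamma\beta$. Then the operations on the underlying space of $A$ defined, for $x,y\in A$, by \begin{align*} x\searrow y&=\beta\bigl(\gamma(x)\bigr)y=\gamma\bigl(\beta(x)\bigr)y,\\ x\nearrow y&=\beta(x)\gamma(y),\\ x\swarrow y&=\gamma(x)\beta(y),\\ x\nwarrow y&=x\beta\bigl(\gamma(y)\bigr)=x\gamma\bigl(\beta(y)\bigr) \end{align*} make $A$ into a quadri-algebra.
   Context: Associative algebras are not required to have a unit. A Baxter operator on an associative algebra $A$ is a linear map $\beta:A\to A$ such that $\beta(x)\beta(y)=\beta\bigl(x\beta(y)+\beta(x)y\bigr)$ for all $x,y\in A$. A quadri-algebra is a vector space $Q$ with four bilinear operations $\searrow,\nearrow,\nwarrow,\swarrow:Q\otimes Q\to Q$ such that, setting $x\succ y:=x\nearrow y+x\searrow y$, $x\prec y:=x\nwarrow y+x\swarrow y$, $x\vee y:=x\searrow y+x\swarrow y$, $x\wedge y:=x\nearrow y+x\nwarrow y$, and $x\star y:=x\searrow y+x\nearrow y+x\nwarrow y+x\swarrow y$, the following nine identities hold for all $x,y,z\in Q$: \begin{align*} &(x\nwarrow y)\nwarrow z=x\nwarrow(y\star z), && (x\nearrow y)\nwarrow z=x\nearrow(y\prec z), && (x\wedge y)\nearrow z=x\nearrow(y\succ z),\\ &(x\swarrow y)\nwarrow z=x\swarrow(y\wedge z), && (x\searrow y)\nwarrow z=x\searrow(y\nwarrow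 z), && (x\vee y)\nearrow z=x\searrow(y\nearrow z),\\ &(x\prec y)\swarrow z=x\swarrow(y\vee z), && (x\succ y)\swarrow z=x\searrow(y\swarrow z), && (x\star y)\searrow z=x\searrow(y\searrow z). \end{align*} *)

theory Defs
  imports Complex_Main
begin

definition bilinear_op :: "('k::field \<Rightarrow> 'a::ab_group_add \<Rightarrow> 'a) \<Rightarrow> ('a \<Rightarrow> 'a \<Rightarrow> 'a) \<Rightarrow> bool"
  where "bilinear_op scale m \<longleftrightarrow>
    (\<forall>x. Vector_Spaces.linear scale scale (\<lambda>y. m x y)) \<and>
    (\<forall>y. Vector_Spaces.linear scale scale (\<lambda>x. m x y))"

text \<open>The class \<^class>\<open>ring\<close> is that of associative rings, not assumed to be unital or commutative.\<close>

locale assoc_algebra = vector_space scale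
  for scale :: "'k::field \<Rightarrow> 'a::ring \<Rightarrow> 'a" +
  assumes bilinear_mult: "bilinear_op scale (*)"

locale baxter_operator = assoc_algebra scale
  for scale :: "'k::field \<Rightarrow> 'a::ring \<Rightarrow> 'a" +
  fixes \<beta> :: "'a \<Rightarrow> 'a"
  assumes linear_op: "Vector_Spaces.linear scale scale \<beta>"
    and baxter: "\<beta> x * \<beta> y = \<beta> (x * \<beta> y + \<beta> x * y)"

locale quadri_ops =
  fixes se :: "'a::ab_group_add \<Rightarrow> 'a \<Rightarrow> 'a"  (infixl \<open>\<searrow>\<close> 70)
    and ne :: "'a \<Rightarrow> 'a \<Rightarrow> 'a"  (infixl \<open>\<nearrow>\<close> 70)
    and nw :: "'a \<Rightarrow> 'a \<Rightarrow> 'a"  (infixl \<open>\<nwarrow>\<close> 70)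
    and sw :: "'a \<Rightarrow> 'a \<Rightarrow> 'a"  (infixl \<open>\<swarrow>\<close> 70)
begin

definition succ_op :: "'a \<Rightarrow> 'a \<Rightarrow> 'a"  (infixl \<open>\<succ>\<close> 70)
  where "x \<succ> y = x \<nearrow> y + x \<searrow> y"

definition prec_op :: "'a \<Rightarrow> 'a \<Rightarrow> 'a"  (infixl \<open>\<prec>\<close> 70)
  where "x \<prec> y = x \<nwarrow> y + x \<swarrow> y"

text \<open>The operations usually written \<open>\<or>\<close> and \<open>\<and>\<close>; those symbols are taken by the
  logical connectives.\<close>

definition vee_op :: "'a \<Rightarrow> 'a \<Rightarrow> 'a"  (infixl \<open>\<squnion>\<close> 70)
  where "x \<squnion> y = x \<searrow> y + x \<swarrow> y"

definition wedge_op :: "'a \<Rightarrow> 'a \<Rightarrow> 'a"  (infixl \<open>\<sqinter>\<close> 70)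
  where "x \<sqinter> y = x \<nearrow> y + x \<nwarrow> y"

definition star_op :: "'a \<Rightarrow> 'a \<Rightarrow> 'a"  (infixl \<open>\<star>\<close> 70)
  where "x \<star> y = x \<searrow> y + x \<nearrow> y + x \<nwarrow> y + x \<swarrow> y"

end

locale quadri_algebra = vector_space scale + quadri_ops se ne nw sw
  for scale :: "'k::field \<Rightarrow> 'a::ab_group_add \<Rightarrow> 'a"
    and se :: "'a \<Rightarrow> 'a \<Rightarrow> 'a"  (infixl \<open>\<searrow>\<close> 70)
    and ne :: "'a \<Rightarrow> 'a \<Rightarrow> 'a"  (infixl \<open>\<nearrow>\<close> 70)
    and nw :: "'a \<Rightarrow> 'a \<Rightarrow> 'a"  (infixl \<open>\<nwarrow>\<close> 70)
    and sw :: "'a \<Rightarrow> 'a \<Rightarrow> 'a"  (infixl \<open>\<swarrow>\<close> 70) +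
  assumes bilinear_se: "bilinear_op scale (\<searrow>)"
    and bilinear_ne: "bilinear_op scale (\<nearrow>)"
    and bilinear_nw: "bilinear_op scale (\<nwarrow>)"
    and bilinear_sw: "bilinear_op scale (\<swarrow>)"
    and quadri_11: "(x \<nwarrow> y) \<nwarrow> z = x \<nwarrow> (y \<star> z)"
    and quadri_12: "(x \<nearrow> y) \<nwarrow> z = x \<nearrow> (y \<prec> z)"
    and quadri_13: "(x \<sqinter> y) \<nearrow> z = x \<nearrow> (y \<succ> z)"
    and quadri_21: "(x \<swarrow> y) \<nwarrow> z = x \<swarrow> (y \<sqinter> z)"
    and quadri_22: "(x \<searrow> y) \<nwarrow> z = x \<searrow> (y \<nwarrow> z)"
    and quadri_23: "(x \<squnion> y) \<nearrow> z = x \<searrow> (y \<nearrow> z)"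
    and quadri_31: "(x \<prec> y) \<swarrow> z = x \<swarrow> (y \<squnion> z)"
    and quadri_32: "(x \<succ> y) \<swarrow> z = x \<searrow> (y \<swarrow> z)"
    and quadri_33: "(x \<star> y) \<searrow> z = x \<searrow> (y \<searrow> z)"

end

theory Submission
  imports Defs
begin

text \<open>A Baxter operator turns a product \<open>\<beta> x * \<beta> y\<close> into a value of \<open>\<beta>\<close>. Since \<open>\<gamma>\<close> commutes
  with \<open>\<beta>\<close>, doing this with both operators gives \<open>\<beta> (\<gamma> x) * \<beta> (\<gamma> y) = \<beta> (\<gamma> (x \<star> y))\<close>. Each
  quadri-algebra identity is then associativity of a triple product whose factors carry
  \<open>\<beta>\<close>, \<open>\<gamma>\<close>, both or neither.\<close>

context assoc_algebra
begin

text \<open>With one argument fixed, the map is a linear map followed by multiplication by a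
  constant. All four operations have this form, with \<open>f\<close> and \<open>g\<close> among the
  identity, \<beta>, \<gamma> and their composite.\<close>

lemma bilinear_op_mult_linear:
  assumes f: "Vector_Spaces.linear scale scale f" and g: "Vector_Spaces.linear scale scale g"
  shows "bilinear_op scale (\<lambda>x y. f x * g y)"
proof -
  have L: "Vector_Spaces.linear scale scale (\<lambda>y. a * y)"
    and R: "Vector_Spaces.linear scale scale (\<lambda>x. x * a)" for a
    using bilinear_mult by (auto simp: bilinear_op_def)
  show ?thesis
    using Vector_Spaces.linear_compose[OF g L] Vector_Spaces.linear_compose[OF f R]
    by (auto simp: bilinear_op_def o_def)
qed

end

theorem corollary2p6:
  fixes scale :: "'k::field \<Rightarrow> 'a::ring \<Rightarrow> 'a"
    and \<beta> \<gamma> :: "'a \<Rightarrow> 'a"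
  assumes "assoc_algebra scale"
    and "baxter_operator scale \<beta>"
    and "baxter_operator scale \<gamma>"
    and "\<beta> \<circ> \<gamma> = \<gamma> \<circ> \<beta>"
  shows "(\<forall>x y. \<beta> (\<gamma> x) * y = \<gamma> (\<beta> x) * y \<and> x * \<beta> (\<gamma> y) = x * \<gamma> (\<beta> y)) \<and>
    quadri_algebra scale
      (\<lambda>x y. \<beta> (\<gamma> x) * y)
      (\<lambda>x y. \<beta> x * \<gamma> y)
      (\<lambda>x y. x * \<beta> (\<gamma> y))
      (\<lambda>x y. \<gamma> x * \<beta> y)"
proof -
  interpret A: assoc_algebra scale by fact
  interpret B: baxter_operator scale \<beta> by fact
  interpret G: baxter_operator scale \<gamma> by fact
  have comm: "\<gamma> (\<beta> x) = \<beta> (\<gamma> x)" for x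
    using assms(4) by (metis comp_apply)
  have lin: "Vector_Spaces.linear scale scale (\<lambda>x. \<beta> (\<gamma> x))"
    using Vector_Spaces.linear_compose[OF G.linear_op B.linear_op] by (simp add: o_def)
  have add: "\<beta> (x + y) = \<beta> x + \<beta> y" "\<gamma> (x + y) = \<gamma> x + \<gamma> y" for x y
    using B.linear_op G.linear_op
    by (auto simp: Vector_Spaces.linear_def dest: module_hom.add)
  have baxter: "\<beta> x * \<beta> y = \<beta> (x * \<beta> y) + \<beta> (\<beta> x * y)"
    "\<gamma> x * \<gamma> y = \<gamma> (x * \<gamma> y) + \<gamma> (\<gamma> x * y)" for x y
    using B.baxter G.baxter by (simp_all add: add)
  \<comment> \<open>The Baxter identity of \<beta> at \<gamma> x and \<gamma> y leaves the products
    \<gamma> x * \<beta> (\<gamma> y) and \<beta> (\<gamma> x) * \<gamma> y inside \<beta>. By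
    commutation both are products of two values of \<gamma>, so the identity of \<gamma> splits each
    into two of the four terms.\<close>
  have star: "\<beta> (\<gamma> x) * \<beta> (\<gamma> y) = \<beta> (\<gamma> (\<beta> (\<gamma> x) * y + \<beta> x * \<gamma> y + x * \<beta> (\<gamma> y) + \<gamma> x * \<beta> y))" for x y
    using baxter(2)[of x "\<beta> y"] baxter(2)[of "\<beta> x" y]
    by (simp add: baxter(1) add comm algebra_simps)
  interpret Q: quadri_ops "\<lambda>x y. \<beta> (\<gamma> x) * y" "\<lambda>x y. \<beta> x * \<gamma> y"
    "\<lambda>x y. x * \<beta> (\<gamma> y)" "\<lambda>x y. \<gamma> x * \<beta> y" .
  note ops = Q.succ_op_def Q.prec_op_def Q.vee_op_def Q.wedge_op_def
  \<comment> \<open>Each two-term sum is the argument on the right of one Baxter identity, with the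
    other operator already applied to one factor.\<close>
  have half: "\<gamma> (Q.succ_op x y) = \<beta> (\<gamma> x) * \<gamma> y" "\<gamma> (Q.prec_op x y) = \<gamma> x * \<beta> (\<gamma> y)"
    "\<beta> (Q.vee_op x y) = \<beta> (\<gamma> x) * \<beta> y" "\<beta> (Q.wedge_op x y) = \<beta> x * \<beta> (\<gamma> y)" for x y
    using baxter(2)[of "\<beta> x" y] baxter(2)[of x "\<beta> y"] baxter(1)[of "\<gamma> x" y] baxter(1)[of x "\<gamma> y"]
    by (simp_all add: ops add comm add.commute)
  have full: "\<beta> (\<gamma> (Q.star_op x y)) = \<beta> (\<gamma> x) * \<beta> (\<gamma> y)" for x y
    by (simp add: star Q.star_op_def)
  \<comment> \<open>In every identity a sum operation occurs only under the operator for which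
    \<open>half\<close> or \<open>full\<close> turns it into a product. The sums therefore stay
    folded, and only reassociation remains.\<close>
  have "quadri_algebra scale (\<lambda>x y. \<beta> (\<gamma> x) * y) (\<lambda>x y. \<beta> x * \<gamma> y)
      (\<lambda>x y. x * \<beta> (\<gamma> y)) (\<lambda>x y. \<gamma> x * \<beta> y)"
    using A.bilinear_op_mult_linear[OF lin A.linear_ident]
      A.bilinear_op_mult_linear[OF B.linear_op G.linear_op]
      A.bilinear_op_mult_linear[OF A.linear_ident lin]
      A.bilinear_op_mult_linear[OF G.linear_op B.linear_op]
    by unfold_locales (simp_all only: half full mult.assoc)
  then show ?thesis
    by (simp add: comm)
qed

end
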